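(* Let $(S_i)_{i\in I}$ be a family of compact spindle starshaped sets in $\mathbb{E}^d$ with $\operatorname{card} I\ge d+1$, and let $K$ be a compact set in $\mathbb{E}^d$. Assume that for every $i_1,\ldots,i_{d+1}\in I$ there is a vector $u\in\mathbb{E}^d$ such that $u+K\subseteq\ker_{\mathrm{s}}\big(\bigcap_{j=1}^{d+1}S_{i_j}\big)$. Then there is a vector $v\in\mathbb{E}^d$ such that $v+K\subseteq\ker_{\mathrm{s}}\big(\bigcap_{i\in I}S_i\big)$.
   Context: For $x,y\in\mathbb{E}^d$ the spindle $[x,y]_{\mathrm{s}}$ is the intersection of all closed unit balls containing $x$ and $y$ if $|x-y|\le2$, and $\mathbb{E}^d$ otherwise. For $A\subseteq\mathbb{E}^d$, $p\in A$: $\operatorname{st}_{\mathrm{s}}(p,A)=\{q\in A:[p,q]_{\mathrm{s}}\subseteq A\}$; $\ker_{\mathrm{s}}A=\{p\in A:\operatorname{st}_{\mathrm{s}}(p,A)=A\}$; $A$ is spindle starshaped if $\ker_{\mathrm{s}}A\ne\emptyset$. *)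

theory Defs
  imports "HOL-Analysis.Analysis"
begin

definition spindle :: "'a::euclidean_space \<Rightarrow> 'a \<Rightarrow> 'a set" where
  "spindle x y = (if dist x y \<le> 2
     then \<Inter> {cball c 1 | c. x \<in> cball c 1 \<and> y \<in> cball c 1}
     else UNIV)"

definition spindle_star :: "'a::euclidean_space \<Rightarrow> 'a set \<Rightarrow> 'a set" where
  "spindle_star p A = {q \<in> A. spindle p q \<subseteq> A}"

definition spindle_kernel :: "'a::euclidean_space set \<Rightarrow> 'a set" where
  "spindle_kernel A = {p \<in> A. spindle_star p A = A}"

definition spindle_starshaped :: "'a::euclidean_space set \<Rightarrow> bool" where
  "spindle_starshaped A \<longleftrightarrow> spindle_kernel A \<noteq> {}"

end

theory Submission
  imports Defs
begin

text \<open>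
  The proof applies a topological Helly theorem not to the sets \<open>S\<^sub>i\<close>, nor to their kernels (kernels of
  intersections are not intersections of kernels), but to the sets \<open>R\<^sub>i\<close> of all \<open>v\<close> such that \<open>v + K\<close>
  and every spindle joining a point of \<open>v + K\<close> to a point of \<open>T = \<Inter>\<^sub>i S\<^sub>i\<close> lie in \<open>S\<^sub>i\<close>. Because \<open>T\<close> is
  the full intersection, a common point of all \<open>R\<^sub>i\<close> is exactly a translate of \<open>K\<close> in the spindle kernel
  of \<open>T\<close>; and whenever \<open>u + K\<close> lies in the spindle kernel of a partial intersection, the corresponding
  intersection of sets \<open>R\<^sub>i\<close> is starshaped about \<open>u\<close>. So one Helly step promotes the hypothesis from
  families of fewer than \<open>n\<close> sets to families of \<open>n\<close> sets (for \<open>n \<ge> d + 2\<close>), and compactness of the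
  \<open>R\<^sub>i\<close> handles infinite families.

  The starshapedness rests on a covering property: if \<open>w\<close> lies on the segment from \<open>p\<close> to \<open>q\<close>, then the
  spindle of \<open>w\<close> and \<open>x\<close> is covered by the spindles joining \<open>p\<close> to the points of the spindle of \<open>q\<close> and
  \<open>x\<close>. It follows from Lagrange multipliers for the farthest point in an intersection of three balls.

  For the Helly step, let \<open>d + 2\<close> compact sets have starshaped proper subintersections. Coning from the
  star centres maps the \<open>(d + 1)\<close>-simplex into \<open>d\<close>-space, each facet landing in one of the sets. If
  there were no common point, the distances to the sets would map their union to the boundary of the simplex; for
  dimension reasons this extends to all of the image, and the composition contradicts Brouwer's theorem.
\<close>

section \<open>Joins of spindles\<close>

text \<open>No unit ball contains two points more than 2 apart, so the condition on centres is then
  vacuous; both cases of the definition merge.\<close>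

lemma spindle_eq:
  "spindle x y = {z. \<forall>c. dist c x \<le> 1 \<and> dist c y \<le> 1 \<longrightarrow> dist c z \<le> 1}"
proof (cases "dist x y \<le> 2")
  case True
  then show ?thesis by (auto simp: spindle_def)
next
  case False
  have "\<not> (dist c x \<le> 1 \<and> dist c y \<le> 1)" for c
    using dist_triangle2[of x y c] False by (auto simp: dist_commute)
  then show ?thesis using False by (auto simp: spindle_def)
qed

lemma spindle_ends [simp]: "x \<in> spindle x y" "y \<in> spindle x y"
  by (auto simp: spindle_eq)

lemma convex_spindle: "convex (spindle x y)"
proof -
  have "spindle x y = (\<Inter>c\<in>{c. dist c x \<le> 1 \<and> dist c y \<le> 1}. cball c 1)"
    by (auto simp: spindle_eq)
  then show ?thesis by (simp add: convex_INT)
qed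

lemma closed_segment_subset_spindle: "closed_segment x y \<subseteq> spindle x y"
  by (simp add: closed_segment_subset convex_spindle)

lemma spindle_mono_right: "y' \<in> spindle x y \<Longrightarrow> spindle x y' \<subseteq> spindle x y"
  by (auto simp: spindle_eq)

text \<open>Active normals have equal length \<open>R\<close>, so the triangle inequality forces
  \<open>a + b \<ge> 1\<close>, and the weighted comparison of squared distances bounds the distance
  to \<open>z\<close>. Radii above 1 occur for smallest enclosing balls.\<close>

lemma mem_spindleI_cone:
  fixes p y z c0 :: "'a::euclidean_space"
  assumes R: "R \<ge> 1" and z: "dist c0 z = R" and ab: "a \<ge> 0" "b \<ge> 0"
    and comb: "c0 - z = a *\<^sub>R (c0 - p) + b *\<^sub>R (c0 - y)"
    and act: "a \<noteq> 0 \<Longrightarrow> dist c0 p = R" "b \<noteq> 0 \<Longrightarrow> dist c0 y = R"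
  shows "z \<in> spindle p y"
proof -
  have nrm: "norm (a *\<^sub>R (c0 - p)) = a * R" "norm (b *\<^sub>R (c0 - y)) = b * R"
    using act ab by (auto simp: dist_norm)
  have "R \<le> a * R + b * R"
    using norm_triangle_ineq[of "a *\<^sub>R (c0 - p)" "b *\<^sub>R (c0 - y)"] z nrm comb
    by (simp add: dist_norm)
  then have "R * 1 \<le> R * (a + b)" by (simp add: algebra_simps)
  then have ab1: "1 \<le> a + b" using R by simp
  have step: "2 * ((c - c0) \<bullet> (t *\<^sub>R (c0 - i))) \<le> - t * (norm (c - c0))\<^sup>2"
    if "t \<ge> 0" "t \<noteq> 0 \<Longrightarrow> dist c0 i = R" "dist c i \<le> R" for c i t
  proof (cases "t = 0")
    case False
    have "(norm (c - i))\<^sup>2 \<le> R\<^sup>2"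
      using that R by (simp add: dist_norm power_mono)
    moreover have "(norm (c0 - i))\<^sup>2 = R\<^sup>2" using that False by (simp add: dist_norm)
    moreover have "(norm (c - i))\<^sup>2 = (norm (c - c0))\<^sup>2 + 2 * ((c - c0) \<bullet> (c0 - i)) + (norm (c0 - i))\<^sup>2"
      by (simp add: power2_norm_eq_inner algebra_simps inner_commute)
    ultimately have "2 * ((c - c0) \<bullet> (c0 - i)) \<le> - (norm (c - c0))\<^sup>2" by linarith
    then have "t * (2 * ((c - c0) \<bullet> (c0 - i))) \<le> t * (- (norm (c - c0))\<^sup>2)"
      using that(1) by (rule mult_left_mono)
    then show ?thesis by (simp only: inner_scaleR_right)
  qed simp
  have big: "dist c z \<le> R" if "dist c p \<le> R" "dist c y \<le> R" for c
  proof -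
    have "(c - c0) \<bullet> (c0 - z) = (c - c0) \<bullet> (a *\<^sub>R (c0 - p)) + (c - c0) \<bullet> (b *\<^sub>R (c0 - y))"
      by (simp only: comb inner_add_right)
    then have "2 * ((c - c0) \<bullet> (c0 - z)) \<le> - a * (norm (c - c0))\<^sup>2 + - b * (norm (c - c0))\<^sup>2"
      using step[OF ab(1) act(1) that(1)] step[OF ab(2) act(2) that(2)] by linarith
    also have "\<dots> = - (a + b) * (norm (c - c0))\<^sup>2" by (simp add: algebra_simps)
    also have "\<dots> \<le> - 1 * (norm (c - c0))\<^sup>2"
      by (rule mult_right_mono) (use ab1 in simp_all)
    finally have "2 * ((c - c0) \<bullet> (c0 - z)) \<le> - (norm (c - c0))\<^sup>2" by simp
    moreover have "(norm (c - z))\<^sup>2 = (norm (c - c0))\<^sup>2 + 2 * ((c - c0) \<bullet> (c0 - z)) + (norm (c0 - z))\<^sup>2"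
      by (simp add: power2_norm_eq_inner algebra_simps inner_commute)
    moreover have "(norm (c0 - z))\<^sup>2 = R\<^sup>2" using z by (simp add: dist_norm)
    ultimately have "(norm (c - z))\<^sup>2 \<le> R\<^sup>2" by linarith
    then show ?thesis unfolding dist_norm by (rule power2_le_imp_le) (use R in simp)
  qed
  have "dist c z \<le> 1" if c: "dist c p \<le> 1" "dist c y \<le> 1" for c
  proof (cases "c = z")
    case False
    \<comment> \<open>Unit balls are intersections of balls of radius \<open>R \<ge> 1\<close>: move \<open>c\<close> away from \<open>z\<close> by \<open>R - 1\<close>.\<close>
    define e where "e = (1 / norm (c - z)) *\<^sub>R (c - z)"
    have e: "norm e = 1" "norm (c - z) *\<^sub>R e = c - z" using False by (simp_all add: e_def)
    have sh: "dist (c + (R - 1) *\<^sub>R e) i \<le> R" if "dist c i \<le> 1" for i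
    proof -
      have "norm ((R - 1) *\<^sub>R e) = R - 1" using e(1) R by simp
      moreover have "c + (R - 1) *\<^sub>R e - i = (c - i) + (R - 1) *\<^sub>R e" by simp
      ultimately show ?thesis
        using norm_triangle_ineq[of "c - i" "(R - 1) *\<^sub>R e"] that by (simp only: dist_norm)
    qed
    have "dist (c + (R - 1) *\<^sub>R e) z \<le> R" using big sh c by blast
    moreover have "c + (R - 1) *\<^sub>R e - z = norm (c - z) *\<^sub>R e + (R - 1) *\<^sub>R e"
      by (simp only: e(2)) simp
    then have "c + (R - 1) *\<^sub>R e - z = (norm (c - z) + (R - 1)) *\<^sub>R e"
      by (simp only: scaleR_add_left)
    then have "norm (c + (R - 1) *\<^sub>R e - z) = \<bar>norm (c - z) + (R - 1)\<bar> * norm e"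
      by (simp only: norm_scaleR)
    ultimately show ?thesis unfolding dist_norm e(1) mult_1_right using R by linarith
  qed simp
  then show ?thesis by (simp add: spindle_eq)
qed

section \<open>Lagrange multipliers for ball constraints\<close>

text \<open>A theorem of the alternative: without multipliers, a hyperplane separates the points
  \<open>g i\<close> from the ray of \<open>n\<close>, and the first component of its normal is a
  direction \<open>e\<close> excluded by \<open>opt\<close>. Used with \<open>n = 0\<close> and with
  \<open>n = c - z\<close>.\<close>

lemma ball_constraints_multipliers:
  fixes p q x c n :: "'a::euclidean_space"
  assumes le: "dist c p \<le> R" "dist c q \<le> R" "dist c x \<le> R"
    and nz: "n \<noteq> 0 \<or> dist c p = R \<or> dist c q = R \<or> dist c x = R"
    and opt: "\<nexists>e. e \<noteq> 0 \<and> e \<bullet> n \<ge> 0 \<and> (\<forall>i\<in>{p,q,x}. dist c i = R \<longrightarrow> e \<bullet> (c - i) < 0)"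
  obtains s \<alpha> \<beta> \<gamma> where "s \<ge> 0" "\<alpha> \<ge> 0" "\<beta> \<ge> 0" "\<gamma> \<ge> 0" "\<alpha> + \<beta> + \<gamma> = (1::real)"
    "s *\<^sub>R n = \<alpha> *\<^sub>R (c - p) + \<beta> *\<^sub>R (c - q) + \<gamma> *\<^sub>R (c - x)"
    "\<alpha> \<noteq> 0 \<longrightarrow> dist c p = R" "\<beta> \<noteq> 0 \<longrightarrow> dist c q = R" "\<gamma> \<noteq> 0 \<longrightarrow> dist c x = R"
proof -
  \<comment> \<open>The second coordinate encodes complementary slackness: it must average to zero.\<close>
  define g where "g i = (c - i, R - dist c i)" for i
  define C where "C = convex hull {g p, g q, g x}"
  define L where "L = (\<lambda>s. s *\<^sub>R (n, 0::real)) ` {0..}"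
  have "C \<inter> L \<noteq> {}"
  proof
    assume dis: "C \<inter> L = {}"
    have L: "closed L" "convex L"
    proof -
      show "convex L" unfolding L_def
        by (intro convex_linear_image convex_real_interval) (auto simp: linear_iff algebra_simps)
      show "closed L"
      proof (cases "n = 0")
        case True
        then have "L = {0}" by (auto simp: L_def zero_prod_def)
        then show ?thesis by simp
      next
        case False
        then show ?thesis unfolding L_def
          by (intro closed_injective_linear_image) (auto simp: linear_iff algebra_simps inj_on_def)
      qed
    qed
    have C: "convex C" "compact C" "C \<noteq> {}"
      by (auto simp: C_def compact_convex_hull finite_imp_compact)
    obtain a b where ab: "\<forall>v\<in>C. a \<bullet> v < b" "\<forall>v\<in>L. a \<bullet> v > b"
      using separating_hyperplane_compact_closed[OF C(1,2,3) L(2,1) dis] by blast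
    define e where "e = fst a"
    have "0 *\<^sub>R (n, 0) \<in> L" unfolding L_def by (rule imageI) simp
    then have "b < a \<bullet> (0 *\<^sub>R (n, 0))" using ab(2) by blast
    then have b0: "b < 0" by (simp add: inner_prod_def)
    have "e \<bullet> n \<ge> 0"
    proof (rule ccontr)
      assume neg: "\<not> e \<bullet> n \<ge> 0"
      then have "b / (e \<bullet> n) \<ge> 0" using b0 by (simp add: divide_nonpos_neg)
      then have "(b / (e \<bullet> n)) *\<^sub>R (n, 0) \<in> L" by (auto simp: L_def)
      then have "a \<bullet> ((b / (e \<bullet> n)) *\<^sub>R (n, 0)) > b" using ab(2) by blast
      then show False using neg by (simp add: e_def inner_prod_def)
    qed
    have act: "e \<bullet> (c - i) < 0" if "i \<in> {p,q,x}" "dist c i = R" for i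
    proof -
      have "g i \<in> C" unfolding C_def using that by (auto intro: hull_inc)
      then have "a \<bullet> g i < b" using ab(1) by blast
      then show ?thesis using that b0 by (simp add: g_def e_def inner_prod_def)
    qed
    show False
    proof (cases "e = 0")
      case False
      then show False using opt \<open>e \<bullet> n \<ge> 0\<close> act by blast
    next
      case True
      \<comment> \<open>A zero direction gives no negative product, so no constraint is active and
        \<open>n\<close> itself violates \<open>opt\<close>.\<close>
      then have no: "dist c i \<noteq> R" if "i \<in> {p,q,x}" for i using act[OF that] by auto
      then have "n \<noteq> 0" using nz by auto
      then show False using opt no by (auto dest: spec[of _ n])
    qed
  qed
  then obtain v where v: "v \<in> C" "v \<in> L" by blast
  obtain s where s: "s \<ge> 0" "v = s *\<^sub>R (n, 0)" using v(2) by (auto simp: L_def)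
  obtain \<alpha> \<beta> \<gamma> where w: "\<alpha> \<ge> 0" "\<beta> \<ge> 0" "\<gamma> \<ge> 0" "\<alpha> + \<beta> + \<gamma> = 1"
    "v = \<alpha> *\<^sub>R g p + \<beta> *\<^sub>R g q + \<gamma> *\<^sub>R g x"
    using v(1) by (auto simp: C_def convex_hull_3)
  have eq: "s *\<^sub>R n = \<alpha> *\<^sub>R (c - p) + \<beta> *\<^sub>R (c - q) + \<gamma> *\<^sub>R (c - x)"
    "0 = \<alpha> * (R - dist c p) + \<beta> * (R - dist c q) + \<gamma> * (R - dist c x)"
    using s(2) w(5) by (simp_all add: g_def)
  have "\<alpha> * (R - dist c p) \<ge> 0" "\<beta> * (R - dist c q) \<ge> 0" "\<gamma> * (R - dist c x) \<ge> 0"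
    using w le by simp_all
  then have "\<alpha> * (R - dist c p) = 0" "\<beta> * (R - dist c q) = 0" "\<gamma> * (R - dist c x) = 0"
    using eq(2) by linarith+
  then show thesis using that[OF s(1) w(1-4) eq(1)] by auto
qed

lemma eventually_dist_less:
  fixes c i e :: "'a::euclidean_space"
  assumes "dist c i \<le> R" "dist c i = R \<Longrightarrow> e \<bullet> (c - i) < 0"
  shows "\<forall>\<^sub>F t in at_right (0::real). dist (c + t *\<^sub>R e) i < R"
proof (cases "dist c i = R")
  case True
  then have "0 < (i - c) \<bullet> e"
    using assms(2) by (simp add: inner_diff_left inner_diff_right inner_commute[of e])
  then obtain u where u: "u > 0" "\<And>v. v > 0 \<Longrightarrow> v \<le> u \<Longrightarrow> norm (v *\<^sub>R e - (i - c)) < norm (i - c)"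
    using closer_points_lemma[of "i - c" e] by blast
  have "dist (c + t *\<^sub>R e) i < R" if "t > 0" "t < u" for t
  proof -
    have "norm (t *\<^sub>R e - (i - c)) < norm (i - c)" using u(2)[of t] that by simp
    moreover have "t *\<^sub>R e - (i - c) = c + t *\<^sub>R e - i" by simp
    ultimately show ?thesis using True by (simp add: dist_norm norm_minus_commute)
  qed
  then show ?thesis using u(1) by (auto simp: eventually_at_right_field intro!: exI[of _ u])
next
  case False
  have "((\<lambda>t. dist (c + t *\<^sub>R e) i) \<longlongrightarrow> dist (c + 0 *\<^sub>R e) i) (at_right 0)"
    by (intro tendsto_intros)
  then show ?thesis using False assms(1) by (intro order_tendstoD(2)) auto
qed

text \<open>The case where the centre \<open>c\<close> of the smallest ball around \<open>p\<close>, \<open>q\<close>, \<open>x\<close> leaves no room: its radius \<open>R\<close>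
  is at least 1, so \<open>c\<close> is the only possible centre of a unit ball containing the three points.\<close>

lemma spindle_join_degenerate:
  fixes p q x z c :: "'a::euclidean_space"
  assumes hull: "\<forall>c. dist c p \<le> 1 \<and> dist c q \<le> 1 \<and> dist c x \<le> 1 \<longrightarrow> dist c z \<le> 1"
    and R: "R \<ge> 1" and le: "dist c p \<le> R" "dist c q \<le> R" "dist c x \<le> R"
    and w: "\<alpha> \<ge> 0" "\<beta> \<ge> 0" "\<gamma> \<ge> 0" "\<alpha> + \<beta> + \<gamma> = 1"
    and eq: "0 = \<alpha> *\<^sub>R (c - p) + \<beta> *\<^sub>R (c - q) + \<gamma> *\<^sub>R (c - x)"
    and act: "\<alpha> \<noteq> 0 \<longrightarrow> dist c p = R" "\<beta> \<noteq> 0 \<longrightarrow> dist c q = R" "\<gamma> \<noteq> 0 \<longrightarrow> dist c x = R"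
  shows "\<exists>y \<in> spindle q x. z \<in> spindle p y"
proof -
  \<comment> \<open>By the parallelogram law, a unit ball containing both \<open>i\<close> and its
    antipode about \<open>c\<close> must have centre \<open>c\<close>, with \<open>R = 1\<close>. So
    \<open>z\<close> is in their spindle, vacuously if \<open>R > 1\<close>.\<close>
  have anti: "dist c' z \<le> 1" if "dist c i = R" "dist c' i \<le> 1" "dist c' (2 *\<^sub>R c - i) \<le> 1" for c' i
  proof -
    have "(norm (c' - i))\<^sup>2 + (norm (c' - (2 *\<^sub>R c - i)))\<^sup>2 = 2 * (norm (c' - c))\<^sup>2 + 2 * (norm (c - i))\<^sup>2"
      by (simp add: power2_norm_eq_inner algebra_simps inner_commute)
    moreover have "(norm (c' - i))\<^sup>2 \<le> 1" "(norm (c' - (2 *\<^sub>R c - i)))\<^sup>2 \<le> 1"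
      using that by (simp_all add: dist_norm power_le_one)
    ultimately have s: "(norm (c' - c))\<^sup>2 + R\<^sup>2 \<le> 1" using that by (simp add: dist_norm)
    moreover have "R\<^sup>2 \<ge> 1" using R by (simp add: one_le_power)
    ultimately have "c' = c" by (smt (verit) zero_less_power2 norm_eq_zero right_minus_eq)
    moreover from this have "R = 1" using s R by (simp add: power_le_one_iff)
    ultimately show ?thesis using hull le by blast
  qed
  show ?thesis
  proof (cases "\<alpha> = 0")
    case True
    have "\<beta> *\<^sub>R (c - q) = - (\<gamma> *\<^sub>R (c - x))" using eq True by (simp add: eq_neg_iff_add_eq_0)
    then have "norm (\<beta> *\<^sub>R (c - q)) = norm (\<gamma> *\<^sub>R (c - x))" by simp
    moreover have "norm (\<beta> *\<^sub>R (c - q)) = \<beta> * R" "norm (\<gamma> *\<^sub>R (c - x)) = \<gamma> * R"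
      using act w by (auto simp: dist_norm)
    ultimately have "\<beta> = \<gamma>" using R by simp
    then have half: "\<beta> = 1/2" "\<gamma> = 1/2" using w True by auto
    have "2 *\<^sub>R ((1/2) *\<^sub>R (c - q) + (1/2) *\<^sub>R (c - x)) = 0" using eq True half by simp
    then have "(c - q) + (c - x) = 0" by (simp only: scaleR_add_right scaleR_scaleR) simp
    then have "x = 2 *\<^sub>R c - q" by (simp add: algebra_simps scaleR_2)
    then have "z \<in> spindle q x" using anti[of q] act half by (auto simp: spindle_eq)
    then show ?thesis by (intro bexI[of _ z]) auto
  next
    case False
    \<comment> \<open>The multipliers make \<open>c - y\<close>, for the antipode \<open>y\<close>
      of \<open>p\<close>, a conic combination over \<open>q\<close> and \<open>x\<close>, which
      puts \<open>y\<close> in their spindle.\<close>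
    define y where "y = 2 *\<^sub>R c - p"
    have "c - y = (1/\<alpha>) *\<^sub>R (\<alpha> *\<^sub>R (p - c))" using False by (simp add: y_def scaleR_2)
    also have "\<alpha> *\<^sub>R (p - c) = \<beta> *\<^sub>R (c - q) + \<gamma> *\<^sub>R (c - x)"
      using eq by (simp add: algebra_simps)
    finally have "c - y = (\<beta>/\<alpha>) *\<^sub>R (c - q) + (\<gamma>/\<alpha>) *\<^sub>R (c - x)"
      by (simp add: scaleR_add_right)
    moreover have "dist c y = R" using act(1) False by (simp add: y_def dist_norm scaleR_2 norm_minus_commute)
    ultimately have "y \<in> spindle q x"
      using w act R by (intro mem_spindleI_cone[of R c y "\<beta>/\<alpha>" "\<gamma>/\<alpha>"]) auto
    moreover have "z \<in> spindle p y" using anti[of p] act(1) False by (auto simp: spindle_eq y_def)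
    ultimately show ?thesis by blast
  qed
qed

text \<open>At the centre of the smallest enclosing ball no direction shortens all active distances
  at once. The centre exists because centres outside \<open>cball p (F p)\<close> are worse than
  \<open>p\<close>.\<close>

lemma circumcenter_multipliers:
  fixes p q x :: "'a::euclidean_space"
  obtains c R \<alpha> \<beta> \<gamma> where "dist c p \<le> R" "dist c q \<le> R" "dist c x \<le> R"
    "\<And>c'. max (dist c' p) (max (dist c' q) (dist c' x)) \<ge> R"
    "\<alpha> \<ge> 0" "\<beta> \<ge> 0" "\<gamma> \<ge> 0" "\<alpha> + \<beta> + \<gamma> = (1::real)"
    "0 = \<alpha> *\<^sub>R (c - p) + \<beta> *\<^sub>R (c - q) + \<gamma> *\<^sub>R (c - x)"
    "\<alpha> \<noteq> 0 \<longrightarrow> dist c p = R" "\<beta> \<noteq> 0 \<longrightarrow> dist c q = R" "\<gamma> \<noteq> 0 \<longrightarrow> dist c x = R"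
proof -
  define F where "F c = max (dist c p) (max (dist c q) (dist c x))" for c
  have "continuous_on (cball p (F p)) F" unfolding F_def by (intro continuous_intros)
  moreover have "dist p p \<le> F p" unfolding F_def by (rule max.cobounded1)
  then have "p \<in> cball p (F p)" by simp
  ultimately obtain c where c: "\<And>c'. c' \<in> cball p (F p) \<Longrightarrow> F c \<le> F c'"
    using continuous_attains_inf[of "cball p (F p)" F] by (metis compact_cball empty_iff)
  have min: "F c \<le> F c'" for c'
  proof (cases "c' \<in> cball p (F p)")
    case False
    then have "F p < dist c' p" by (simp add: dist_commute)
    also have "\<dots> \<le> F c'" unfolding F_def by (rule max.cobounded1)
    finally have "F p < F c'" .
    then show ?thesis using c[of p] \<open>p \<in> cball p (F p)\<close> by simp
  qed (rule c)
  define R where "R = F c"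
  have le: "dist c p \<le> R" "dist c q \<le> R" "dist c x \<le> R" by (auto simp: R_def F_def)
  have "dist c p = R \<or> dist c q = R \<or> dist c x = R" by (auto simp: R_def F_def max_def)
  then have nz: "(0::'a) \<noteq> 0 \<or> dist c p = R \<or> dist c q = R \<or> dist c x = R" by simp
  have opt: "\<nexists>e. e \<noteq> 0 \<and> e \<bullet> 0 \<ge> 0 \<and> (\<forall>i\<in>{p,q,x}. dist c i = R \<longrightarrow> e \<bullet> (c - i) < 0)"
  proof (rule notI, elim exE conjE)
    fix e assume e: "\<forall>i\<in>{p,q,x}. dist c i = R \<longrightarrow> e \<bullet> (c - i) < 0"
    have "\<forall>\<^sub>F t in at_right (0::real). dist (c + t *\<^sub>R e) i < R" if "i \<in> {p,q,x}" for i
      using le that e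
      by (intro eventually_dist_less) auto
    then have "\<forall>\<^sub>F t in at_right (0::real). dist (c + t *\<^sub>R e) p < R \<and> dist (c + t *\<^sub>R e) q < R \<and> dist (c + t *\<^sub>R e) x < R"
      by (intro eventually_conj) auto
    then obtain t :: real where "dist (c + t *\<^sub>R e) p < R \<and> dist (c + t *\<^sub>R e) q < R \<and> dist (c + t *\<^sub>R e) x < R"
      using eventually_happens' trivial_limit_at_right_real by blast
    then have "F (c + t *\<^sub>R e) < R" by (simp add: F_def)
    then show False using min[of "c + t *\<^sub>R e"] by (simp add: R_def)
  qed
  obtain s \<alpha> \<beta> \<gamma> where "s \<ge> 0" "\<alpha> \<ge> 0" "\<beta> \<ge> 0" "\<gamma> \<ge> 0" "\<alpha> + \<beta> + \<gamma> = (1::real)"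
    "s *\<^sub>R (0::'a) = \<alpha> *\<^sub>R (c - p) + \<beta> *\<^sub>R (c - q) + \<gamma> *\<^sub>R (c - x)"
    "\<alpha> \<noteq> 0 \<longrightarrow> dist c p = R" "\<beta> \<noteq> 0 \<longrightarrow> dist c q = R" "\<gamma> \<noteq> 0 \<longrightarrow> dist c x = R"
    by (rule ball_constraints_multipliers[OF le nz opt]) (rule that; assumption)
  then show thesis using that[OF le, of \<alpha> \<beta> \<gamma>] min by (simp add: R_def F_def)
qed

text \<open>Here \<open>c\<close> is an admissible centre farthest from \<open>z\<close>.
  Multipliers write \<open>c - z\<close> conically in \<open>c - p\<close>, \<open>c - q\<close>,
  \<open>c - x\<close>; projecting the part from \<open>q\<close> and \<open>x\<close> onto the unit
  sphere about \<open>c\<close> gives \<open>y\<close>.\<close>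

lemma spindle_join_boundary:
  fixes p q x z c :: "'a::euclidean_space"
  assumes hull: "\<forall>c. dist c p \<le> 1 \<and> dist c q \<le> 1 \<and> dist c x \<le> 1 \<longrightarrow> dist c z \<le> 1"
    and c: "dist c p \<le> 1" "dist c q \<le> 1" "dist c x \<le> 1" "dist c z = 1"
  shows "\<exists>y \<in> spindle q x. z \<in> spindle p y"
proof (cases "z = p")
  case False
  define n where "n = c - z"
  have n: "norm n = 1" using c by (simp add: n_def dist_norm)
  \<comment> \<open>A small move along such an \<open>e\<close> keeps the centre admissible, yet the
    quadratic term takes it strictly farther than 1 from \<open>z\<close>, even if \<open>e\<close>
    is orthogonal to \<open>n\<close>.\<close>
  have opt: "\<nexists>e. e \<noteq> 0 \<and> e \<bullet> n \<ge> 0 \<and> (\<forall>i\<in>{p,q,x}. dist c i = 1 \<longrightarrow> e \<bullet> (c - i) < 0)"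
  proof (rule notI, elim exE conjE)
    fix e assume e: "e \<noteq> 0" "e \<bullet> n \<ge> 0" "\<forall>i\<in>{p,q,x}. dist c i = 1 \<longrightarrow> e \<bullet> (c - i) < 0"
    have "\<forall>\<^sub>F t in at_right (0::real). dist (c + t *\<^sub>R e) i < 1" if "i \<in> {p,q,x}" for i
      using c that e(3) by (intro eventually_dist_less) auto
    then have "\<forall>\<^sub>F t in at_right (0::real). t > 0 \<and> dist (c + t *\<^sub>R e) p < 1 \<and> dist (c + t *\<^sub>R e) q < 1 \<and> dist (c + t *\<^sub>R e) x < 1"
      by (intro eventually_conj) (auto simp: eventually_at_right_less)
    then obtain t :: real where t: "t > 0" "dist (c + t *\<^sub>R e) p < 1" "dist (c + t *\<^sub>R e) q < 1" "dist (c + t *\<^sub>R e) x < 1"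
      using eventually_happens' trivial_limit_at_right_real by blast
    then have "norm (n + t *\<^sub>R e) \<le> 1"
      using hull[rule_format, of "c + t *\<^sub>R e"] by (simp add: dist_norm n_def algebra_simps)
    then have "(norm (n + t *\<^sub>R e))\<^sup>2 \<le> 1" by (simp add: power_le_one)
    moreover have "(norm (n + t *\<^sub>R e))\<^sup>2 = (norm n)\<^sup>2 + 2 * t * (e \<bullet> n) + t\<^sup>2 * (norm e)\<^sup>2"
      by (simp only: power2_norm_eq_inner) (simp add: algebra_simps inner_commute power2_eq_square)
    moreover have "2 * t * (e \<bullet> n) \<ge> 0" "t\<^sup>2 * (norm e)\<^sup>2 > 0" using t(1) e by auto
    ultimately show False using n by simp
  qed
  have "n \<noteq> 0" using n by auto
  then have nz: "n \<noteq> 0 \<or> dist c p = 1 \<or> dist c q = 1 \<or> dist c x = 1" ..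
  obtain s \<alpha> \<beta> \<gamma> where s: "s \<ge> 0" and w: "\<alpha> \<ge> 0" "\<beta> \<ge> 0" "\<gamma> \<ge> 0" "\<alpha> + \<beta> + \<gamma> = (1::real)"
    and eq: "s *\<^sub>R n = \<alpha> *\<^sub>R (c - p) + \<beta> *\<^sub>R (c - q) + \<gamma> *\<^sub>R (c - x)"
    and act: "\<alpha> \<noteq> 0 \<longrightarrow> dist c p = 1" "\<beta> \<noteq> 0 \<longrightarrow> dist c q = 1" "\<gamma> \<noteq> 0 \<longrightarrow> dist c x = 1"
    by (rule ball_constraints_multipliers[OF c(1-3) nz opt]) (rule that; assumption)
  show ?thesis
  proof (cases "s = 0")
    case True
    then have "0 = \<alpha> *\<^sub>R (c - p) + \<beta> *\<^sub>R (c - q) + \<gamma> *\<^sub>R (c - x)" using eq by simp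
    then show ?thesis by (rule spindle_join_degenerate[OF hull order_refl c(1-3) w _ act])
  next
    case False
    define v where "v = \<beta> *\<^sub>R (c - q) + \<gamma> *\<^sub>R (c - x)"
    have "\<alpha> *\<^sub>R (c - p) + v = s *\<^sub>R n" by (simp add: v_def eq add.assoc)
    then have neq: "n = (1/s) *\<^sub>R (\<alpha> *\<^sub>R (c - p) + v)" using False by simp
    \<comment> \<open>Otherwise \<open>n\<close> and \<open>c - p\<close> would be unit vectors in
      the same direction, giving \<open>z = p\<close>.\<close>
    have "v \<noteq> 0"
    proof
      assume "v = 0"
      then have n': "n = (\<alpha>/s) *\<^sub>R (c - p)" using neq by simp
      then have "\<alpha> \<noteq> 0" using \<open>n \<noteq> 0\<close> by auto
      then have "\<alpha>/s = 1" using n n' act(1) s w by (simp add: dist_norm)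
      then show False using n' \<open>z \<noteq> p\<close> by (simp add: n_def)
    qed
    define y where "y = c - (1 / norm v) *\<^sub>R v"
    have cy: "c - y = (1 / norm v) *\<^sub>R v" by (simp add: y_def)
    have dy: "dist c y = 1" using \<open>v \<noteq> 0\<close> by (simp add: dist_norm cy)
    have "c - y = (\<beta> / norm v) *\<^sub>R (c - q) + (\<gamma> / norm v) *\<^sub>R (c - x)"
      unfolding cy by (subst v_def) (simp add: scaleR_add_right)
    then have "y \<in> spindle q x"
      using w act dy by (intro mem_spindleI_cone[of 1 c y "\<beta> / norm v" "\<gamma> / norm v"]) auto
    moreover have "c - z = (\<alpha> / s) *\<^sub>R (c - p) + (norm v / s) *\<^sub>R (c - y)"
      using neq \<open>v \<noteq> 0\<close> by (simp add: cy n_def scaleR_add_right)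
    then have "z \<in> spindle p y"
      using w s act dy c(4) by (intro mem_spindleI_cone[of 1 c z "\<alpha> / s" "norm v / s"]) auto
    ultimately show ?thesis by blast
  qed
qed (intro bexI[of _ q], auto)

section \<open>The covering property of spindles\<close>

text \<open>If no unit ball contains \<open>p\<close>, \<open>q\<close>, \<open>x\<close>, their
  smallest enclosing ball decides. Otherwise points at distance exactly 1 from an admissible centre
  suffice, since a spindle from \<open>p\<close> contains the segments from \<open>p\<close> to its
  points.\<close>

lemma spindle_join:
  fixes p q x z :: "'a::euclidean_space"
  assumes hull: "\<forall>c. dist c p \<le> 1 \<and> dist c q \<le> 1 \<and> dist c x \<le> 1 \<longrightarrow> dist c z \<le> 1"
  shows "\<exists>y \<in> spindle q x. z \<in> spindle p y"
proof -
  define N where "N = cball p 1 \<inter> cball q 1 \<inter> cball x 1"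
  define H where "H = (\<Inter>c\<in>N. cball c 1)"
  have NI: "c \<in> N \<longleftrightarrow> dist c p \<le> 1 \<and> dist c q \<le> 1 \<and> dist c x \<le> 1" for c
    by (auto simp: N_def dist_commute)
  consider "N = {}" | "z = p" | "N \<noteq> {}" "z \<noteq> p" by blast
  then show ?thesis
  proof cases
    case 1
    obtain c R \<alpha> \<beta> \<gamma> where *: "dist c p \<le> R" "dist c q \<le> R" "dist c x \<le> R"
      "\<And>c'. max (dist c' p) (max (dist c' q) (dist c' x)) \<ge> R"
      "\<alpha> \<ge> 0" "\<beta> \<ge> 0" "\<gamma> \<ge> 0" "\<alpha> + \<beta> + \<gamma> = (1::real)"
      "0 = \<alpha> *\<^sub>R (c - p) + \<beta> *\<^sub>R (c - q) + \<gamma> *\<^sub>R (c - x)"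
      "\<alpha> \<noteq> 0 \<longrightarrow> dist c p = R" "\<beta> \<noteq> 0 \<longrightarrow> dist c q = R" "\<gamma> \<noteq> 0 \<longrightarrow> dist c x = R"
      by (rule circumcenter_multipliers[of p q x]) (rule that; assumption)
    have "R \<ge> 1" using 1 NI[of c] *(1-3) by force
    then show ?thesis by (rule spindle_join_degenerate[OF hull _ *(1-3,5-)])
  next
    case 2
    then show ?thesis by (intro bexI[of _ q]) auto
  next
    case 3
    \<comment> \<open>Push \<open>z\<close> along the ray from \<open>p\<close> to the boundary of the ball hull \<open>H\<close> of \<open>p\<close>, \<open>q\<close>, \<open>x\<close>.\<close>
    define r where "r t = p + t *\<^sub>R (z - p)" for t :: real
    define Z where "Z = {t. t \<ge> 1 \<and> r t \<in> H}"
    obtain c1 where c1: "c1 \<in> N" using 3 by blast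
    have "closed H" by (auto simp: H_def)
    then have "closed Z"
      unfolding Z_def r_def by (intro closed_Collect_conj closed_Collect_le continuous_closed_vimage[unfolded vimage_def] continuous_intros)
    moreover have "bounded Z"
    proof -
      have "\<bar>t\<bar> \<le> 2 / norm (z - p)" if "t \<in> Z" for t
      proof -
        have "dist c1 (r t) \<le> 1" "dist c1 p \<le> 1" using that c1 by (auto simp: Z_def H_def NI)
        then have "dist (r t) p \<le> 2" using dist_triangle[of "r t" p c1] by (simp add: dist_commute)
        then have "\<bar>t\<bar> * norm (z - p) \<le> 2" by (simp add: r_def dist_norm)
        then show ?thesis using 3 by (simp add: field_simps)
      qed
      then show ?thesis unfolding bounded_iff by (auto simp: intro!: exI[of _ "2 / norm (z - p)"])
    qed
    ultimately have "compact Z" by (simp add: compact_eq_bounded_closed)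
    moreover have "1 \<in> Z" using hull by (auto simp: Z_def r_def H_def NI)
    ultimately obtain t where t: "t \<in> Z" "\<And>t'. t' \<in> Z \<Longrightarrow> t' \<le> t"
      using compact_attains_sup[of Z] by blast
    have "compact N" by (simp add: N_def compact_Int)
    moreover have "continuous_on N (\<lambda>c. dist c (r t))" by (intro continuous_intros)
    ultimately obtain c where c: "c \<in> N" "\<And>c'. c' \<in> N \<Longrightarrow> dist c' (r t) \<le> dist c (r t)"
      using continuous_attains_sup[of N "\<lambda>c. dist c (r t)"] 3 by blast
    have rt: "dist c' (r t) \<le> 1" if "c' \<in> N" for c' using t(1) that by (auto simp: Z_def H_def)
    have "dist c (r t) = 1"
    proof (rule ccontr)
      assume "dist c (r t) \<noteq> 1"
      then have lt: "dist c (r t) < 1" using rt[OF c(1)] by simp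
      \<comment> \<open>The slack at the farthest centre, measured in the ray parameter: advancing
        by it stays in \<open>H\<close>, against the maximality of \<open>t\<close>.\<close>
      define \<delta> where "\<delta> = (1 - dist c (r t)) / norm (z - p)"
      have \<delta>: "\<delta> > 0" "\<delta> * norm (z - p) = 1 - dist c (r t)" using lt 3 by (auto simp: \<delta>_def)
      have "dist c' (r (t + \<delta>)) \<le> 1" if "c' \<in> N" for c'
      proof -
        have "dist (r t) (r (t + \<delta>)) = \<delta> * norm (z - p)"
          using \<delta> by (simp add: r_def dist_norm scaleR_add_left)
        then show ?thesis using dist_triangle[of c' "r (t + \<delta>)" "r t"] c(2)[OF that] \<delta>(2) by simp
      qed
      then have "t + \<delta> \<in> Z" using t(1) \<delta> by (auto simp: Z_def H_def)
      then show False using t(2) \<delta>(1) by force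
    qed
    then obtain y where y: "y \<in> spindle q x" "r t \<in> spindle p y"
      using spindle_join_boundary[of p q x "r t" c] rt c(1) NI by blast
    have "t \<ge> 1" using t(1) by (simp add: Z_def)
    then have "z \<in> closed_segment p (r t)"
      by (auto simp: in_segment r_def algebra_simps intro!: exI[of _ "1/t"])
    then show ?thesis
      using y closed_segment_subset_spindle[of p "r t"] spindle_mono_right[OF y(2)] by blast
  qed
qed

lemma spindle_join_segment:
  assumes "w \<in> closed_segment p q" "z \<in> spindle w x"
  shows "\<exists>y \<in> spindle q x. z \<in> spindle p y"
proof (rule spindle_join)
  have "w \<in> spindle p q" using assms(1) closed_segment_subset_spindle by blast
  then show "\<forall>c. dist c p \<le> 1 \<and> dist c q \<le> 1 \<and> dist c x \<le> 1 \<longrightarrow> dist c z \<le> 1"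
    using assms(2) by (auto simp: spindle_eq)
qed

text \<open>A point of a spindle pushed towards the end point \<open>x\<close> is interior enough to survive perturbing \<open>q\<close>.\<close>

lemma closed_spindle_subset:
  fixes S :: "'a::euclidean_space set"
  assumes "closed S"
  shows "closed {q. spindle q x \<subseteq> S}"
  unfolding closed_sequential_limits
proof (intro allI impI, elim conjE)
  fix q l assume q: "\<forall>n. q n \<in> {q. spindle q x \<subseteq> S}" and lim: "q \<longlonglongrightarrow> l"
  have "z \<in> S" if z: "z \<in> spindle l x" for z
  proof (cases "z = x")
    case True
    then show ?thesis using q by (auto simp: subset_iff)
  next
    case False
    have mem: "x + \<theta> *\<^sub>R (z - x) \<in> S" if \<theta>: "\<theta> \<in> {0<..<1}" for \<theta> :: real
    proof -
      define y where "y = x + \<theta> *\<^sub>R (z - x)"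
      \<comment> \<open>Otherwise excluding centres accumulate at a \<open>c'\<close> whose unit
        ball contains \<open>x\<close> and \<open>z\<close> but does not have \<open>y\<close> in
        its interior, although \<open>y\<close> lies strictly between them.\<close>
      have "\<exists>n. y \<in> spindle (q n) x"
      proof (rule ccontr)
        assume "\<not> ?thesis"
        then have "\<forall>n. \<exists>c. dist c (q n) \<le> 1 \<and> dist c x \<le> 1 \<and> dist c y > 1"
          by (auto simp: spindle_eq not_le)
        then obtain c where c: "\<And>n. dist (c n) (q n) \<le> 1" "\<And>n. dist (c n) x \<le> 1" "\<And>n. dist (c n) y > 1"
          by metis
        then have "\<forall>n. c n \<in> cball x 1" by (auto simp: dist_commute)
        then obtain c' f where f: "strict_mono f" "(c \<circ> f) \<longlonglongrightarrow> c'"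
          using compact_cball[of x 1] unfolding compact_def by blast
        have "(\<lambda>n. dist ((c \<circ> f) n) ((q \<circ> f) n)) \<longlonglongrightarrow> dist c' l"
          by (intro tendsto_dist f LIMSEQ_subseq_LIMSEQ lim)
        then have 1: "dist c' l \<le> 1" by (rule LIMSEQ_le_const2) (use c in auto)
        have "(\<lambda>n. dist ((c \<circ> f) n) x) \<longlonglongrightarrow> dist c' x" by (intro tendsto_intros f)
        then have 2: "dist c' x \<le> 1" by (rule LIMSEQ_le_const2) (use c in auto)
        have "(\<lambda>n. dist ((c \<circ> f) n) y) \<longlonglongrightarrow> dist c' y" by (intro tendsto_intros f)
        then have 3: "dist c' y \<ge> 1" by (rule LIMSEQ_le_const) (metis c(3) comp_apply less_imp_le)
        have "dist c' z \<le> 1" using z 1 2 by (auto simp: spindle_eq)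
        moreover have "y \<in> open_segment x z"
        proof -
          have "y = (1 - \<theta>) *\<^sub>R x + \<theta> *\<^sub>R z" by (simp add: y_def algebra_simps)
          then have "0 < \<theta> \<and> \<theta> < 1 \<and> y = (1 - \<theta>) *\<^sub>R x + \<theta> *\<^sub>R z" using \<theta> by simp
          then show ?thesis using False unfolding in_segment by blast
        qed
        ultimately have "dist c' y < 1"
          using 2 dist_decreases_open_segment[of y x z c'] by (meson order_less_le_trans)
        then show False using 3 by simp
      qed
      then show ?thesis using q by (auto simp: y_def)
    qed
    have "((\<lambda>\<theta>. x + \<theta> *\<^sub>R (z - x)) \<longlongrightarrow> x + 1 *\<^sub>R (z - x)) (at_left (1::real))"
      by (intro tendsto_intros)
    moreover have "\<forall>\<^sub>F \<theta> in at_left (1::real). x + \<theta> *\<^sub>R (z - x) \<in> S"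
      using mem by (auto simp: eventually_at_left_field intro!: exI[of _ 0])
    ultimately have "x + 1 *\<^sub>R (z - x) \<in> S"
      by (intro Lim_in_closed_set[OF assms _ trivial_limit_at_left_real])
    then show ?thesis by simp
  qed
  then show "l \<in> {q. spindle q x \<subseteq> S}" by blast
qed

section \<open>A Helly theorem for starshaped intersections\<close>

text \<open>Induction peels off the largest member \<open>M\<close>: the rest averages to a point of
  \<open>A M\<close>, and the full average lies on the segment from \<open>u M\<close> to that
  point.\<close>

lemma starlike_chain_combination:
  fixes A :: "'b set \<Rightarrow> 'a::real_vector set"
  assumes "finite W" "W \<noteq> {}"
    and "\<And>F G. F \<in> W \<Longrightarrow> G \<in> W \<Longrightarrow> F \<subseteq> G \<or> G \<subseteq> F"
    and "\<And>F G. F \<in> W \<Longrightarrow> G \<in> W \<Longrightarrow> F \<subseteq> G \<Longrightarrow> A F \<subseteq> A G"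
    and "\<And>F v. F \<in> W \<Longrightarrow> v \<in> A F \<Longrightarrow> closed_segment (u F) v \<subseteq> A F"
    and "\<And>F. F \<in> W \<Longrightarrow> u F \<in> A F"
    and "\<And>F. F \<in> W \<Longrightarrow> w F > (0::real)"
  shows "\<exists>M\<in>W. (\<forall>F\<in>W. F \<subseteq> M) \<and> (1 / sum w W) *\<^sub>R (\<Sum>F\<in>W. w F *\<^sub>R u F) \<in> A M"
  using assms
proof (induction W rule: finite_psubset_induct)
  case (psubset W)
  obtain M where M: "M \<in> W" "\<And>F. F \<in> W \<Longrightarrow> M \<subseteq> F \<Longrightarrow> M = F"
    using finite_has_maximal[OF psubset.hyps(1) psubset.prems(1)] by auto
  have top: "F \<subseteq> M" if "F \<in> W" for F using psubset.prems(2)[OF that M(1)] M(2)[OF that] by auto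
  have wM: "w M > 0" using psubset.prems(6) M(1) by blast
  define W' where "W' = W - {M}"
  have split: "sum w W = w M + sum w W'"
    "(\<Sum>F\<in>W. w F *\<^sub>R u F) = w M *\<^sub>R u M + (\<Sum>F\<in>W'. w F *\<^sub>R u F)"
    unfolding W'_def using psubset.hyps(1) M(1) by (auto intro: sum.remove)
  show ?case
  proof (cases "W' = {}")
    case True
    then have "(1 / sum w W) *\<^sub>R (\<Sum>F\<in>W. w F *\<^sub>R u F) = u M" using split wM by simp
    then show ?thesis using M(1) top psubset.prems(5) by auto
  next
    case False
    have W': "W' \<subset> W" using M(1) by (auto simp: W'_def)
    then have sub: "\<And>F. F \<in> W' \<Longrightarrow> F \<in> W" by auto
    have "\<exists>M\<in>W'. (\<forall>F\<in>W'. F \<subseteq> M) \<and> (1 / sum w W') *\<^sub>R (\<Sum>F\<in>W'. w F *\<^sub>R u F) \<in> A M"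
    proof (rule psubset.IH[OF W' False])
      show "F \<subseteq> G \<or> G \<subseteq> F" if "F \<in> W'" "G \<in> W'" for F G
        using that by (intro psubset.prems(2) sub)
      show "A F \<subseteq> A G" if "F \<in> W'" "G \<in> W'" "F \<subseteq> G" for F G
        using that by (intro psubset.prems(3) sub)
      show "closed_segment (u F) v \<subseteq> A F" if "F \<in> W'" "v \<in> A F" for F v
        using that by (intro psubset.prems(4) sub)
      show "u F \<in> A F" "w F > 0" if "F \<in> W'" for F
        using that by (auto intro: psubset.prems(5,6) sub)
    qed
    then obtain M' where M': "M' \<in> W'" "(1 / sum w W') *\<^sub>R (\<Sum>F\<in>W'. w F *\<^sub>R u F) \<in> A M'"
      by blast
    define q where "q = (1 / sum w W') *\<^sub>R (\<Sum>F\<in>W'. w F *\<^sub>R u F)"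
    have "q \<in> A M" unfolding q_def using M' psubset.prems(3)[OF sub[OF M'(1)] M(1)] top sub by blast
    then have seg: "closed_segment (u M) q \<subseteq> A M" using psubset.prems(4) M(1) by blast
    have s': "sum w W' > 0"
      using psubset.prems(6) sub False psubset.hyps(1) W' by (intro sum_pos) (auto dest: finite_subset)
    define t where "t = sum w W' / sum w W"
    have t: "0 \<le> t" "t \<le> 1" "1 - t = w M / sum w W"
      using s' wM split(1) by (auto simp: t_def field_simps)
    have "(\<Sum>F\<in>W'. w F *\<^sub>R u F) = sum w W' *\<^sub>R q" using s' by (simp add: q_def)
    then have "(1 / sum w W) *\<^sub>R (\<Sum>F\<in>W. w F *\<^sub>R u F) = (1 - t) *\<^sub>R u M + t *\<^sub>R q"
      unfolding t(3) split(2) by (simp add: t_def scaleR_add_right)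
    then have "(1 / sum w W) *\<^sub>R (\<Sum>F\<in>W. w F *\<^sub>R u F) \<in> closed_segment (u M) q"
      using t by (auto simp: in_segment)
    then show ?thesis using seg M(1) top by blast
  qed
qed

text \<open>The \<open>l v\<close> act as barycentric coordinates. \<open>A F\<close> keeps the
  conditions from indices outside \<open>F\<close>, so it grows with \<open>F\<close>; at
  \<open>F = J\<close> it is the whole space and any point is a star centre.\<close>

lemma starlike_family_map:
  fixes l :: "'b \<Rightarrow> 'x::topological_space \<Rightarrow> real" and B :: "'b \<Rightarrow> 'a::real_normed_vector set"
  assumes J: "finite J" and cont: "\<And>v. v \<in> J \<Longrightarrow> continuous_on X (l v)"
    and nonneg: "\<And>v x. v \<in> J \<Longrightarrow> x \<in> X \<Longrightarrow> l v x \<ge> 0"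
    and pos: "\<And>x. x \<in> X \<Longrightarrow> \<exists>v\<in>J. l v x > 0"
    and star: "\<And>G. G \<subseteq> J \<Longrightarrow> G \<noteq> {} \<Longrightarrow> G \<noteq> J \<Longrightarrow> starlike (\<Inter>k\<in>G. B k)"
  shows "\<exists>f. continuous_on X f \<and> (\<forall>x\<in>X. \<forall>k\<in>J. l k x = 0 \<longrightarrow> f x \<in> B k)"
proof -
  define A where "A F = (\<Inter>k\<in>J - F. B k)" for F
  have "\<exists>u. u \<in> A F \<and> (\<forall>v\<in>A F. closed_segment u v \<subseteq> A F)" if "F \<subseteq> J" "F \<noteq> {}" for F
  proof (cases "F = J")
    case False
    then show ?thesis using star[of "J - F"] that unfolding A_def starlike_def by blast
  qed (auto simp: A_def)
  then obtain u where u: "\<And>F. F \<subseteq> J \<Longrightarrow> F \<noteq> {} \<Longrightarrow> u F \<in> A F"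
    "\<And>F v. F \<subseteq> J \<Longrightarrow> F \<noteq> {} \<Longrightarrow> v \<in> A F \<Longrightarrow> closed_segment (u F) v \<subseteq> A F"
    by metis
  \<comment> \<open>At each point the sets \<open>F\<close> of nonzero weight form a chain: this is the piecewise linear map on the
    barycentric subdivision sending the barycentre of a face \<open>F\<close> to \<open>u F\<close>, up to reparametrisation.\<close>
  define w where "w F x = (\<Prod>v\<in>F. l v x) * (\<Prod>v\<in>F. \<Prod>k\<in>J - F. max 0 (l v x - l k x))" for F x
  define \<W> where "\<W> = {F. F \<subseteq> J \<and> F \<noteq> {}}"
  have fin\<W>: "finite \<W>" using J by (auto simp: \<W>_def)
  have finF: "finite F" if "F \<in> \<W>" for F using that J by (auto simp: \<W>_def dest: finite_subset)
  have w0: "w F x \<ge> 0" if "F \<in> \<W>" "x \<in> X" for F x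
    using that nonneg by (auto simp: w_def \<W>_def intro!: mult_nonneg_nonneg prod_nonneg)
  have wpos: "w F x > 0 \<longleftrightarrow> (\<forall>v\<in>F. l v x > 0 \<and> (\<forall>k\<in>J - F. l v x > l k x))"
    if "F \<in> \<W>" "x \<in> X" for F x
  proof -
    have "w F x > 0 \<longleftrightarrow> w F x \<noteq> 0" using w0[OF that] by linarith
    also have "\<dots> \<longleftrightarrow> (\<forall>v\<in>F. l v x \<noteq> 0) \<and> (\<forall>v\<in>F. \<forall>k\<in>J - F. max 0 (l v x - l k x) \<noteq> 0)"
      using J finF[OF that(1)] by (simp add: w_def)
    also have "\<dots> \<longleftrightarrow> (\<forall>v\<in>F. l v x > 0 \<and> (\<forall>k\<in>J - F. l v x > l k x))"
    proof -
      have "l v x \<noteq> 0 \<longleftrightarrow> l v x > 0" if "v \<in> F" for v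
        using nonneg[of v x] that \<open>F \<in> \<W>\<close> \<open>x \<in> X\<close> by (force simp: \<W>_def)
      moreover have "max 0 (l v x - l k x) \<noteq> 0 \<longleftrightarrow> l v x > l k x" for v k by linarith
      ultimately show ?thesis by blast
    qed
    finally show ?thesis .
  qed
  have ex: "\<exists>F\<in>\<W>. w F x > 0" if x: "x \<in> X" for x
  proof -
    obtain v0 where v0: "v0 \<in> J" "l v0 x > 0" using pos x by blast
    define m where "m = Max ((\<lambda>v. l v x) ` J)"
    define F where "F = {v \<in> J. l v x = m}"
    have le: "l v x \<le> m" if "v \<in> J" for v using that J by (simp add: m_def)
    have "m \<in> (\<lambda>v. l v x) ` J" using J v0(1) unfolding m_def by (intro Max_in) auto
    then have F: "F \<in> \<W>" by (auto simp: F_def \<W>_def)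
    moreover have "w F x > 0" unfolding wpos[OF F x] using le v0 by (force simp: F_def)
    ultimately show ?thesis by blast
  qed
  define s where "s x = (\<Sum>F\<in>\<W>. w F x)" for x
  define f where "f x = (1 / s x) *\<^sub>R (\<Sum>F\<in>\<W>. w F x *\<^sub>R u F)" for x
  have spos: "s x > 0" if "x \<in> X" for x
    unfolding s_def using ex[OF that] w0 that fin\<W> by (auto intro: sum_pos2)
  have cw: "continuous_on X (w F)" if "F \<in> \<W>" for F
    unfolding w_def using that cont by (intro continuous_intros) (auto simp: \<W>_def)
  have "continuous_on X s" unfolding s_def by (intro continuous_intros cw)
  then have "continuous_on X f"
    unfolding f_def using spos by (intro continuous_intros cw) force+
  moreover have "f x \<in> B k" if x: "x \<in> X" and k: "k \<in> J" "l k x = 0" for x k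
  proof -
    define W where "W = {F \<in> \<W>. w F x > 0}"
    have W: "finite W" "W \<noteq> {}" "W \<subseteq> \<W>" using fin\<W> ex[OF x] by (auto simp: W_def)
    have z: "w F x = 0" if "F \<in> \<W> - W" for F using that w0[of F x] x by (force simp: W_def)
    have sums: "sum (\<lambda>F. w F x) W = s x" "(\<Sum>F\<in>W. w F x *\<^sub>R u F) = (\<Sum>F\<in>\<W>. w F x *\<^sub>R u F)"
      unfolding s_def using fin\<W> W(3) z by (auto intro!: sum.mono_neutral_left)
    have "\<exists>M\<in>W. (\<forall>F\<in>W. F \<subseteq> M) \<and>
      (1 / sum (\<lambda>F. w F x) W) *\<^sub>R (\<Sum>F\<in>W. w F x *\<^sub>R u F) \<in> A M"
    proof (rule starlike_chain_combination[OF W(1,2)])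
      fix F G assume FG: "F \<in> W" "G \<in> W"
      \<comment> \<open>Sets of positive weight are upper level sets of the values of
        \<open>l\<close> at \<open>x\<close>, hence nested.\<close>
      show "F \<subseteq> G \<or> G \<subseteq> F"
      proof (rule ccontr)
        assume "\<not> ?thesis"
        then obtain a b where "a \<in> F" "a \<notin> G" "b \<in> G" "b \<notin> F" by blast
        moreover have "F \<subseteq> J" "G \<subseteq> J" using FG by (auto simp: W_def \<W>_def)
        ultimately have "l a x > l b x" "l b x > l a x"
          using FG wpos[of F x] wpos[of G x] x by (auto simp: W_def)
        then show False by simp
      qed
    next
      fix F assume "F \<in> W"
      then show "u F \<in> A F" "w F x > 0" using u(1) by (auto simp: W_def \<W>_def)
    next
      fix F v assume "F \<in> W" "v \<in> A F"
      then show "closed_segment (u F) v \<subseteq> A F" using u(2)[of F v] by (auto simp: W_def \<W>_def)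
    qed (auto simp: A_def)
    then obtain M where M: "M \<in> W" "f x \<in> A M" by (auto simp: sums f_def)
    \<comment> \<open>Positive weight requires \<open>l\<close> to be positive on \<open>M\<close>,
      so \<open>k\<close> is outside and \<open>B k\<close> is among the sets intersected in
      \<open>A M\<close>.\<close>
    then have "k \<notin> M" using wpos[of M x] x k by (force simp: W_def)
    then show "f x \<in> B k" using M(2) k by (auto simp: A_def)
  qed
  ultimately show ?thesis by blast
qed

text \<open>The standard simplex has the vertices \<open>0\<close> and the basis vectors, which also serve as the index set of the
  \<open>d + 2\<close> sets; hence the type \<open>'a \<times> real\<close> of dimension \<open>d + 1\<close> below.\<close>

definition bary_coord :: "'n::euclidean_space \<Rightarrow> 'n \<Rightarrow> real" where
  "bary_coord v x = (if v = 0 then 1 - (\<Sum>b\<in>Basis. x \<bullet> b) else x \<bullet> v)"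

definition bary_point :: "('n \<Rightarrow> real) \<Rightarrow> 'n::euclidean_space" where
  "bary_point t = (\<Sum>b\<in>Basis. t b *\<^sub>R b)"

lemma continuous_on_bary [continuous_intros]:
  "continuous_on X f \<Longrightarrow> continuous_on X (\<lambda>x. bary_coord v (f x))"
  unfolding bary_coord_def by (cases "v = 0") (auto intro!: continuous_intros)

lemma bary_0: "bary_coord 0 x = 1 - (\<Sum>b\<in>Basis. x \<bullet> b)"
  by (simp add: bary_coord_def)

lemma bary_Basis: "v \<in> Basis \<Longrightarrow> bary_coord v x = x \<bullet> v"
  using zero_not_in_Basis by (metis bary_coord_def)

lemma sum_vertices:
  fixes t :: "'n::euclidean_space \<Rightarrow> real"
  shows "(\<Sum>v\<in>insert 0 Basis. t v) = t 0 + (\<Sum>b\<in>Basis. t b)"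
  by (rule sum.insert[OF finite_Basis zero_not_in_Basis])

lemma sum_bary_coord: "(\<Sum>v\<in>insert 0 Basis. bary_coord v x) = 1" for x :: "'n::euclidean_space"
proof -
  have "(\<Sum>b\<in>Basis. bary_coord b x) = (\<Sum>b\<in>Basis. x \<bullet> b)"
    by (rule sum.cong) (simp_all add: bary_Basis)
  then show ?thesis unfolding sum_vertices by (simp add: bary_0)
qed

lemma std_simplex_bary:
  "x \<in> convex hull (insert 0 Basis) \<longleftrightarrow> (\<forall>v\<in>insert 0 Basis. bary_coord v x \<ge> 0)" for x :: "'n::euclidean_space"
  by (simp add: std_simplex bary_0 bary_Basis conj_commute)

lemma interior_std_simplex_bary:
  "x \<in> interior (convex hull (insert 0 Basis)) \<longleftrightarrow> (\<forall>v\<in>insert 0 Basis. bary_coord v x > 0)" for x :: "'n::euclidean_space"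
  by (simp add: interior_std_simplex bary_0 bary_Basis conj_commute)

lemma rel_frontier_std_simplex_bary:
  fixes x :: "'n::euclidean_space"
  shows "x \<in> rel_frontier (convex hull (insert 0 Basis)) \<longleftrightarrow>
    (\<forall>v\<in>insert 0 Basis. bary_coord v x \<ge> 0) \<and> (\<exists>v\<in>insert 0 Basis. bary_coord v x = 0)"
proof -
  have "interior (convex hull (insert 0 Basis)) \<noteq> ({}::'n set)"
    by (metis interior_std_simplex_nonempty empty_iff)
  then have "rel_interior (convex hull (insert 0 Basis)) = interior (convex hull (insert 0 (Basis::'n set)))"
    by (rule rel_interior_nonempty_interior)
  moreover have "closure (convex hull (insert 0 Basis)) = convex hull (insert 0 (Basis::'n set))"
    by (intro closure_closed compact_imp_closed compact_convex_hull finite_imp_compact) simp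
  ultimately have "x \<in> rel_frontier (convex hull (insert 0 Basis)) \<longleftrightarrow>
      (\<forall>v\<in>insert 0 Basis. bary_coord v x \<ge> 0) \<and> \<not> (\<forall>v\<in>insert 0 Basis. bary_coord v x > 0)"
    by (simp only: rel_frontier_def Diff_iff std_simplex_bary interior_std_simplex_bary)
  moreover have "bary_coord v x > 0 \<longleftrightarrow> bary_coord v x \<noteq> 0" if "bary_coord v x \<ge> 0" for v using that by linarith
  ultimately show ?thesis by blast
qed

lemma bary_bary_point:
  fixes t :: "'n::euclidean_space \<Rightarrow> real"
  assumes "(\<Sum>v\<in>insert 0 Basis. t v) = 1" "v \<in> insert 0 Basis"
  shows "bary_coord v (bary_point t) = t v"
proof -
  have b: "bary_point t \<bullet> b = t b" if "b \<in> Basis" for b using that by (simp add: bary_point_def)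
  then have "(\<Sum>b\<in>Basis. bary_point t \<bullet> b) = (\<Sum>b\<in>Basis. t b)" by simp
  then show ?thesis using assms b unfolding sum_vertices by (auto simp: bary_coord_def)
qed

lemma continuous_on_bary_point [continuous_intros]:
  assumes "\<And>b. b \<in> Basis \<Longrightarrow> continuous_on X (\<lambda>x. t x b)"
  shows "continuous_on X (\<lambda>x. bary_point (t x))"
  unfolding bary_point_def using assms by (intro continuous_intros)

section \<open>Brouwer's theorem and the Helly step\<close>

text \<open>Brouwer is applied to \<open>\<tau>\<close> after \<open>p\<close>. At a fixed point
  \<open>x\<close>, a largest coordinate \<open>k\<close> of \<open>p x\<close> is positive, while
  \<open>\<tau>\<close> makes coordinate \<open>k\<close> of \<open>x\<close> zero.\<close>

lemma simplex_boundary_map_escapes: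
  fixes p :: "'n::euclidean_space \<Rightarrow> 'n"
  defines "\<Delta> \<equiv> convex hull (insert 0 Basis)"
  assumes cont: "continuous_on \<Delta> p" and into: "p \<in> \<Delta> \<rightarrow> rel_frontier \<Delta>"
  obtains x v where "x \<in> \<Delta>" "v \<in> insert 0 Basis" "bary_coord v x = 0" "bary_coord v (p x) > 0"
proof -
  let ?J = "insert 0 (Basis::'n set)"
  have finJ: "finite ?J" by simp
  \<comment> \<open>\<open>t k y\<close> vanishes exactly when the coordinate \<open>k\<close> of \<open>y\<close> is maximal, hence positive; so normalising
    \<open>t\<close> sends \<open>y\<close> to a boundary point on a facet that does not contain \<open>y\<close>.\<close>
  define t where "t k y = (\<Sum>j\<in>?J. max 0 (bary_coord j y - bary_coord k y))" for k y
  define T where "T y = (\<Sum>k\<in>?J. t k y)" for y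
  have t0: "t k y \<ge> 0" for k y unfolding t_def by (rule sum_nonneg) simp
  have argmax: "\<exists>k\<in>?J. t k y = 0 \<and> bary_coord k y > 0" if y: "y \<in> \<Delta>" for y
  proof -
    define m where "m = Max ((\<lambda>j. bary_coord j y) ` ?J)"
    have "m \<in> (\<lambda>j. bary_coord j y) ` ?J" unfolding m_def by (rule Max_in) simp_all
    then obtain k where k: "k \<in> ?J" "m = bary_coord k y" by blast
    have "bary_coord j y \<le> bary_coord k y" if "j \<in> ?J" for j
      unfolding k(2)[symmetric] m_def using that finJ by (intro Max_ge finite_imageI imageI)
    note k = k(1) this
    have "t k y = 0" unfolding t_def using k by (intro sum.neutral) auto
    moreover have "bary_coord k y > 0"
    proof (rule ccontr)
      assume "\<not> ?thesis"
      then have "\<And>j. j \<in> ?J \<Longrightarrow> bary_coord j y \<le> 0" using k(2) by force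
      then have "(\<Sum>j\<in>?J. bary_coord j y) \<le> 0" by (rule sum_nonpos)
      then show False using sum_bary_coord[of y] by simp
    qed
    ultimately show ?thesis using k(1) by blast
  qed
  have Tpos: "T y > 0" if y: "y \<in> rel_frontier \<Delta>" for y
  proof -
    obtain z where z: "z \<in> ?J" "bary_coord z y = 0" and "y \<in> \<Delta>"
      using y unfolding \<Delta>_def rel_frontier_std_simplex_bary std_simplex_bary by blast
    then obtain k where k: "k \<in> ?J" "bary_coord k y > 0" using argmax by blast
    have "t z y > 0" unfolding t_def by (rule sum_pos2[OF finJ k(1)]) (use k z in auto)
    then show ?thesis unfolding T_def by (rule sum_pos2[OF finJ z(1)]) (rule t0)
  qed
  define \<tau> where "\<tau> y = bary_point (\<lambda>k. t k y / T y)" for y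
  have \<tau>: "bary_coord k (\<tau> y) = t k y / T y" if "y \<in> rel_frontier \<Delta>" "k \<in> ?J" for k y
    unfolding \<tau>_def
  proof (rule bary_bary_point[OF _ that(2)])
    show "(\<Sum>v\<in>?J. t v y / T y) = 1"
      unfolding sum_divide_distrib[symmetric] T_def[symmetric] using Tpos[OF that(1)] by simp
  qed
  have ct: "continuous_on \<Delta> (\<lambda>x. t k (p x))" for k
    unfolding t_def by (intro continuous_intros cont)
  have "continuous_on \<Delta> (\<lambda>x. \<tau> (p x))"
    unfolding \<tau>_def
  proof (intro continuous_intros ct)
    show "continuous_on \<Delta> (\<lambda>x. T (p x))" unfolding T_def by (intro continuous_intros ct)
    show "\<forall>x\<in>\<Delta>. T (p x) \<noteq> 0" using Tpos into by fastforce
  qed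
  moreover have "(\<lambda>x. \<tau> (p x)) \<in> \<Delta> \<rightarrow> \<Delta>"
  proof
    fix x assume "x \<in> \<Delta>"
    then have px: "p x \<in> rel_frontier \<Delta>" using into by blast
    then show "\<tau> (p x) \<in> \<Delta>"
      unfolding \<Delta>_def std_simplex_bary using \<tau>[OF px] Tpos[OF px] t0 by simp
  qed
  moreover have "compact \<Delta>" "convex \<Delta>" "\<Delta> \<noteq> {}"
    unfolding \<Delta>_def by (intro compact_convex_hull finite_imp_compact finJ, simp_all)
  ultimately obtain x where x: "x \<in> \<Delta>" "\<tau> (p x) = x" using brouwer[of \<Delta> "\<lambda>x. \<tau> (p x)"] by blast
  have px: "p x \<in> rel_frontier \<Delta>" using x(1) into by blast
  then have "p x \<in> \<Delta>" unfolding \<Delta>_def rel_frontier_std_simplex_bary std_simplex_bary by blast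
  then obtain k where k: "k \<in> ?J" "t k (p x) = 0" "bary_coord k (p x) > 0" using argmax by blast
  have "bary_coord k x = 0" using \<tau>[OF px k(1)] x(2) k(2) by simp
  then show thesis using that x(1) k by blast
qed

text \<open>\<open>f\<close> sends facet \<open>k\<close> into \<open>B k\<close> and
  \<open>g\<close> sends \<open>B k\<close> into facet \<open>k\<close>, so the composition would
  preserve every facet, contrary to \<open>simplex_boundary_map_escapes\<close>.\<close>

lemma starlike_helly_simplex:
  fixes B :: "'a::euclidean_space \<times> real \<Rightarrow> 'a set"
  assumes comp: "\<And>k. k \<in> insert 0 Basis \<Longrightarrow> compact (B k)"
    and star: "\<And>G. G \<subseteq> insert 0 Basis \<Longrightarrow> G \<noteq> {} \<Longrightarrow> G \<noteq> insert 0 Basis \<Longrightarrow> starlike (\<Inter>k\<in>G. B k)"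
  shows "(\<Inter>k\<in>insert 0 Basis. B k) \<noteq> {}"
proof
  let ?J = "insert 0 (Basis :: ('a \<times> real) set)"
  define \<Delta> where "\<Delta> = convex hull ?J"
  assume emp: "(\<Inter>k\<in>?J. B k) = {}"
  have finJ: "finite ?J" by simp
  have cl: "closed (B k)" if "k \<in> ?J" for k using comp[OF that] by (rule compact_imp_closed)
  \<comment> \<open>Singletons are proper subfamilies, so each set is nonempty. This matters because
    \<open>infdist\<close> to the empty set is 0.\<close>
  have ne: "B k \<noteq> {}" if "k \<in> ?J" for k
  proof -
    have "card ?J = DIM('a \<times> real) + 1" by (simp add: card_insert_if)
    then have "?J \<noteq> {k}" by (metis DIM_positive add_cancel_left_left card_1_singleton_iff less_irrefl One_nat_def)
    then show ?thesis using star[of "{k}"] that unfolding starlike_def by auto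
  qed
  define U where "U = (\<Union>k\<in>?J. B k)"
  have U: "compact U" unfolding U_def using comp finJ by (intro compact_UN) auto
  define s where "s y = (\<Sum>k\<in>?J. infdist y (B k))" for y
  have spos: "s y > 0" for y
  proof -
    obtain k where k: "k \<in> ?J" "y \<notin> B k" using emp by blast
    then have "infdist y (B k) > 0" using infdist_pos_not_in_closed[OF cl ne] by blast
    then show ?thesis unfolding s_def by (rule sum_pos2[OF finJ k(1)]) (rule infdist_nonneg)
  qed
  define g where "g y = bary_point (\<lambda>k. infdist y (B k) / s y)" for y
  have g: "bary_coord k (g y) = infdist y (B k) / s y" if "k \<in> ?J" for k y
    unfolding g_def
  proof (rule bary_bary_point[OF _ that])
    show "(\<Sum>v\<in>?J. infdist y (B v) / s y) = 1"
      unfolding sum_divide_distrib[symmetric] s_def[symmetric] using spos[of y] by simp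
  qed
  have "continuous_on U s" unfolding s_def by (intro continuous_intros)
  moreover have "\<forall>y\<in>U. s y \<noteq> 0" using spos by (metis less_irrefl)
  ultimately have contg: "continuous_on U g"
    unfolding g_def by (intro continuous_intros) auto
  have gU: "g \<in> U \<rightarrow> rel_frontier \<Delta>"
  proof
    fix y assume "y \<in> U"
    then obtain k where k: "k \<in> ?J" "y \<in> B k" unfolding U_def by blast
    have "bary_coord k (g y) = 0" using g[OF k(1)] k(2) by simp
    moreover have "\<forall>v\<in>?J. bary_coord v (g y) \<ge> 0" using g spos[of y] by (simp add: infdist_nonneg)
    ultimately show "g y \<in> rel_frontier \<Delta>"
      unfolding \<Delta>_def rel_frontier_std_simplex_bary using k(1) by blast
  qed
  have pos: "\<exists>v\<in>?J. bary_coord v x > 0" for x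
  proof (rule ccontr)
    assume "\<not> ?thesis"
    then have "(\<Sum>j\<in>?J. bary_coord j x) \<le> 0" by (intro sum_nonpos) force
    then show False using sum_bary_coord[of x] by simp
  qed
  have "\<exists>f. continuous_on \<Delta> f \<and> (\<forall>x\<in>\<Delta>. \<forall>k\<in>?J. bary_coord k x = 0 \<longrightarrow> f x \<in> B k)"
  proof (rule starlike_family_map)
    show "continuous_on \<Delta> (bary_coord v)" for v :: "'a \<times> real"
      by (rule continuous_on_bary[OF continuous_on_id])
    show "bary_coord v x \<ge> 0" if "v \<in> ?J" "x \<in> \<Delta>" for v x
      using that unfolding \<Delta>_def std_simplex_bary by blast
    show "\<exists>v\<in>?J. bary_coord v x > 0" for x by (rule pos)
    show "starlike (\<Inter>k\<in>G. B k)" if "G \<subseteq> ?J" "G \<noteq> {}" "G \<noteq> ?J" for G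
      using that by (rule star)
  qed (rule finJ)
  then obtain f where f: "continuous_on \<Delta> f"
    "\<And>x k. x \<in> \<Delta> \<Longrightarrow> k \<in> ?J \<Longrightarrow> bary_coord k x = 0 \<Longrightarrow> f x \<in> B k"
    by blast
  have comp\<Delta>: "compact \<Delta>" unfolding \<Delta>_def by (intro compact_convex_hull finite_imp_compact finJ)
  then have "bounded (f ` \<Delta> \<union> U)"
    using U f(1) by (simp add: compact_continuous_image compact_imp_bounded)
  then obtain a where a: "f ` \<Delta> \<union> U \<subseteq> cbox (-a) a" using bounded_subset_cbox_symmetric by blast
  have "aff_dim \<Delta> = DIM('a \<times> real)"
  proof -
    have "interior \<Delta> \<noteq> {}" unfolding \<Delta>_def by (metis interior_std_simplex_nonempty empty_iff)
    then show ?thesis by (rule aff_dim_nonempty_interior)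
  qed
  \<comment> \<open>The box has dimension at most \<open>DIM('a)\<close>, below that of the simplex,
    so maps into the simplex boundary extend over it.\<close>
  then have aff: "aff_dim (cbox (-a) a) < aff_dim \<Delta>" using aff_dim_le_DIM[of "cbox (-a) a"] by simp
  have "\<exists>h. continuous_on (cbox (-a) a) h \<and> h \<in> cbox (-a) a \<rightarrow> rel_frontier \<Delta> \<and> (\<forall>y\<in>U. h y = g y)"
  proof (rule extend_map_cell_complex_to_sphere)
    show "finite {cbox (-a) a}" "U \<subseteq> \<Union>{cbox (-a) a}" using a by auto
    show "closed U" using U by (rule compact_imp_closed)
    show "bounded \<Delta>" using comp\<Delta> by (rule compact_imp_bounded)
    show "convex \<Delta>" unfolding \<Delta>_def by (rule convex_convex_hull)
    show "continuous_on U g" "g \<in> U \<rightarrow> rel_frontier \<Delta>" by fact+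
    show "polytope X" "aff_dim X < aff_dim \<Delta>" if "X \<in> {cbox (-a) a}" for X
      using that aff by (simp_all add: polytope_interval)
    show "X \<inter> Y face_of X" if "X \<in> {cbox (-a) a}" "Y \<in> {cbox (-a) a}" for X Y
      using that by (simp add: face_of_refl)
  next
    fix h assume "continuous_on (\<Union>{cbox (-a) a}) h" "h \<in> \<Union>{cbox (-a) a} \<rightarrow> rel_frontier \<Delta>"
      "\<And>y. y \<in> U \<Longrightarrow> h y = g y"
    then show ?thesis by (intro exI[of _ h]) simp
  qed
  then obtain h where h: "continuous_on (cbox (-a) a) h" "h \<in> cbox (-a) a \<rightarrow> rel_frontier \<Delta>"
    "\<And>y. y \<in> U \<Longrightarrow> h y = g y"
    by blast
  have "continuous_on \<Delta> (h \<circ> f)"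
    using f(1) continuous_on_subset[OF h(1)] a by (intro continuous_on_compose) simp_all
  moreover have "h \<circ> f \<in> \<Delta> \<rightarrow> rel_frontier \<Delta>" using h(2) a by fastforce
  ultimately obtain x v where x: "x \<in> \<Delta>" "v \<in> ?J" "bary_coord v x = 0" "bary_coord v ((h \<circ> f) x) > 0"
    using simplex_boundary_map_escapes[of "h \<circ> f"] unfolding \<Delta>_def by blast
  have fx: "f x \<in> B v" using f(2) x by blast
  then have "h (f x) = g (f x)" using h(3) x(2) by (auto simp: U_def)
  then show False using x(2,4) g[of v "f x"] fx by simp
qed

theorem starlike_helly:
  fixes B :: "'i \<Rightarrow> 'a::euclidean_space set"
  assumes card: "card J = DIM('a) + 2"
    and comp: "\<And>k. k \<in> J \<Longrightarrow> compact (B k)"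
    and star: "\<And>G. G \<subseteq> J \<Longrightarrow> G \<noteq> {} \<Longrightarrow> G \<noteq> J \<Longrightarrow> starlike (\<Inter>k\<in>G. B k)"
  shows "(\<Inter>k\<in>J. B k) \<noteq> {}"
proof -
  let ?V = "insert 0 (Basis :: ('a \<times> real) set)"
  have "finite J" using card card.infinite by fastforce
  moreover have "card ?V = card J" using card by (simp add: card_insert_if)
  ultimately obtain \<phi> where \<phi>: "bij_betw \<phi> ?V J" using bij_betw_iff_card[of ?V J] by auto
  have im: "\<phi> ` ?V = J" and inj: "inj_on \<phi> ?V" using \<phi> by (simp_all add: bij_betw_def)
  have "(\<Inter>k\<in>?V. (B \<circ> \<phi>) k) \<noteq> {}"
  proof (rule starlike_helly_simplex)
    show "compact ((B \<circ> \<phi>) k)" if "k \<in> ?V" for k using comp[of "\<phi> k"] im that by auto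
    fix G assume G: "G \<subseteq> ?V" "G \<noteq> {}" "G \<noteq> ?V"
    then have "\<phi> ` G \<noteq> J" using im inj inj_on_image_eq_iff[OF inj G(1), of ?V] by blast
    then have "starlike (\<Inter>k\<in>\<phi> ` G. B k)" using star[of "\<phi> ` G"] G im by blast
    then show "starlike (\<Inter>k\<in>G. (B \<circ> \<phi>) k)" by (simp add: image_image)
  qed
  then show ?thesis by (simp only: im[symmetric] image_image o_def) simp
qed

section \<open>Translates into spindle kernels\<close>

text \<open>Membership of \<open>v + k\<close> in \<open>S\<close> is a separate clause because
  \<open>T\<close> may be empty. Keeping \<open>T\<close> fixed while \<open>S\<close> varies makes
  the construction commute with intersections.\<close>

definition spindle_reach :: "'a::euclidean_space set \<Rightarrow> 'a set \<Rightarrow> 'a set \<Rightarrow> 'a set" where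
  "spindle_reach K T S = {v. \<forall>k\<in>K. v + k \<in> S \<and> (\<forall>x\<in>T. spindle (v + k) x \<subseteq> S)}"

lemma spindle_reach_iff:
  "v \<in> spindle_reach K T S \<longleftrightarrow> (\<forall>k\<in>K. v + k \<in> S) \<and> (\<forall>k\<in>K. \<forall>x\<in>T. spindle (v + k) x \<subseteq> S)"
  by (auto simp: spindle_reach_def)

lemma spindle_reach_INT:
  "(\<Inter>i\<in>G. spindle_reach K T (S i)) = spindle_reach K T (\<Inter>i\<in>G. S i)"
  unfolding set_eq_iff INT_iff spindle_reach_iff le_INF_iff by blast

lemma spindle_reach_INT_Union:
  "(\<Inter>G\<in>\<G>. spindle_reach K T (\<Inter>i\<in>G. S i)) = spindle_reach K T (\<Inter>i\<in>\<Union>\<G>. S i)"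
  unfolding spindle_reach_INT[symmetric] by blast

lemma compact_spindle_reach:
  assumes "compact S" "K \<noteq> {}"
  shows "compact (spindle_reach K T S)"
proof -
  have S: "closed S" using assms(1) by (rule compact_imp_closed)
  have *: "closed {v. v + k \<in> X}" if "closed X" for X :: "'a set" and k
  proof -
    have "closed ((\<lambda>v. v + k) -` X)" using that by (intro closed_vimage continuous_intros)
    then show ?thesis by (simp only: vimage_def)
  qed
  have "spindle_reach K T S = (\<Inter>k\<in>K. {v. v + k \<in> S} \<inter> (\<Inter>x\<in>T. {v. v + k \<in> {q. spindle q x \<subseteq> S}}))"
    by (auto simp: spindle_reach_def)
  moreover have "closed \<dots>"
    by (intro closed_INT ballI closed_Int *[OF S] *[OF closed_spindle_subset[OF S]])
  ultimately have "closed (spindle_reach K T S)" by simp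
  moreover obtain k where "k \<in> K" using assms(2) by blast
  then have "spindle_reach K T S \<subseteq> (\<lambda>s. s - k) ` S"
    unfolding spindle_reach_def by (intro subsetI, rule_tac x = "x + k" in image_eqI) simp_all
  moreover have "compact ((\<lambda>s. s - k) ` S)"
    using assms(1) by (intro compact_continuous_image continuous_intros)
  ultimately show ?thesis by (metis compact_Int_closed inf.absorb_iff2)
qed

lemma spindle_kernelD:
  assumes "p \<in> spindle_kernel S"
  shows "p \<in> S" "q \<in> S \<Longrightarrow> spindle p q \<subseteq> S"
  using assms by (auto simp: spindle_kernel_def spindle_star_def)

lemma kernel_translate_in_spindle_reach:
  assumes "(\<lambda>k. u + k) ` K \<subseteq> spindle_kernel S" "T \<subseteq> S"
  shows "u \<in> spindle_reach K T S"
  using assms spindle_kernelD unfolding spindle_reach_def by blast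

lemma spindle_reach_self:
  assumes "v \<in> spindle_reach K S S"
  shows "(\<lambda>k. v + k) ` K \<subseteq> spindle_kernel S"
  using assms by (auto simp: spindle_reach_def spindle_kernel_def spindle_star_def)

text \<open>The star centre is \<open>u\<close>: a point of the spindle of \<open>w + k\<close> and
  \<open>x\<close> lies in the spindle of \<open>u + k\<close> and some \<open>y\<close> in the
  spindle of \<open>v + k\<close> and \<open>x\<close>. That \<open>y\<close> is in
  \<open>S\<close>, and \<open>u + k\<close> is in the kernel.\<close>

lemma starlike_spindle_reach:
  assumes u: "(\<lambda>k. u + k) ` K \<subseteq> spindle_kernel S" and T: "T \<subseteq> S"
  shows "starlike (spindle_reach K T S)"
  unfolding starlike_def
proof (intro bexI[OF _ kernel_translate_in_spindle_reach[OF u T]] ballI subsetI)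
  fix v w assume v: "v \<in> spindle_reach K T S" and w: "w \<in> closed_segment u v"
  have "w + k \<in> S \<and> (\<forall>x\<in>T. spindle (w + k) x \<subseteq> S)" if k: "k \<in> K" for k
  proof -
    have uk: "u + k \<in> spindle_kernel S" using u k by blast
    have vk: "v + k \<in> S" "\<And>x. x \<in> T \<Longrightarrow> spindle (v + k) x \<subseteq> S"
      using v k by (auto simp: spindle_reach_def)
    have wk: "w + k \<in> closed_segment (u + k) (v + k)"
      using imageI[OF w, of "(+) k"] unfolding closed_segment_translation[of k u v, symmetric]
      by (simp only: add.commute[of k])
    then have "w + k \<in> S"
      using spindle_kernelD(2)[OF uk vk(1)] closed_segment_subset_spindle by blast
    moreover have "spindle (w + k) x \<subseteq> S" if x: "x \<in> T" for x
    proof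
      fix z assume "z \<in> spindle (w + k) x"
      then obtain y where "y \<in> spindle (v + k) x" "z \<in> spindle (u + k) y"
        using spindle_join_segment[OF wk] by blast
      then show "z \<in> S" using vk(2)[OF x] spindle_kernelD(2)[OF uk] by blast
    qed
    ultimately show ?thesis by blast
  qed
  then show "w \<in> spindle_reach K T S" by (simp add: spindle_reach_def)
qed

section \<open>From small families to arbitrary families\<close>

lemma compact_INT_nonempty:
  fixes S :: "'i \<Rightarrow> 'a::t2_space set"
  assumes "G \<noteq> {}" "\<And>i. i \<in> G \<Longrightarrow> compact (S i)"
  shows "compact (\<Inter>i\<in>G. S i)"
proof -
  obtain i where i: "i \<in> G" using assms(1) by blast
  have "closed (\<Inter>i\<in>G. S i)" using assms(2) by (intro closed_INT ballI compact_imp_closed)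
  then have "compact (S i \<inter> (\<Inter>i\<in>G. S i))" using assms(2)[OF i] by (rule compact_Int_closed[rotated])
  moreover have "S i \<inter> (\<Inter>i\<in>G. S i) = (\<Inter>i\<in>G. S i)" using i by blast
  ultimately show ?thesis by simp
qed

text \<open>Induction over proper subsets, with \<open>T\<close> the intersection over the current
  \<open>J\<close>: a common point of the reach sets translates \<open>K\<close> into the kernel of
  \<open>T\<close>.\<close>

lemma kernel_translate_finite:
  fixes S :: "'i \<Rightarrow> 'a::euclidean_space set"
  assumes comp: "\<And>i. i \<in> J \<Longrightarrow> compact (S i)" and K: "K \<noteq> {}"
    and J: "finite J" "J \<noteq> {}"
    and small: "\<And>G. G \<subseteq> J \<Longrightarrow> G \<noteq> {} \<Longrightarrow> card G \<le> DIM('a) + 1 \<Longrightarrow>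
      \<exists>u. (\<lambda>k. u + k) ` K \<subseteq> spindle_kernel (\<Inter>i\<in>G. S i)"
  shows "\<exists>u. (\<lambda>k. u + k) ` K \<subseteq> spindle_kernel (\<Inter>i\<in>J. S i)"
  using J comp small
proof (induction J rule: finite_psubset_induct)
  case (psubset J)
  show ?case
  proof (cases "card J \<le> DIM('a) + 1")
    case True
    then show ?thesis using psubset.prems(1,3) by blast
  next
    case False
    then have "DIM('a) + 1 \<le> card J" by simp
    then obtain J0 where J0: "J0 \<subseteq> J" "card J0 = DIM('a) + 1" "finite J0"
      using obtain_subset_with_card_n by metis
    have rest: "J - J0 \<noteq> {}" using False J0 card_mono[OF J0(3), of J] by auto
    \<comment> \<open>Grouping all but \<open>d + 1\<close> indices into one block leaves exactly \<open>d + 2\<close> sets for Helly.\<close>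
    define \<G> where "\<G> = insert (J - J0) ((\<lambda>j. {j}) ` J0)"
    have "card ((\<lambda>j. {j}) ` J0) = card J0" by (rule card_image) simp
    moreover have "J - J0 \<notin> (\<lambda>j. {j}) ` J0" by blast
    ultimately have card: "card \<G> = DIM('a) + 2" using J0 by (simp add: \<G>_def)
    have ne: "G \<noteq> {}" "G \<subseteq> J" if "G \<in> \<G>" for G using that rest J0(1) by (auto simp: \<G>_def)
    have disj: "G \<inter> H = {}" if "G \<in> \<G>" "H \<in> \<G>" "G \<noteq> H" for G H using that by (auto simp: \<G>_def)
    have Un: "\<Union>\<G> = J" using J0(1) by (auto simp: \<G>_def)
    define T where "T = (\<Inter>i\<in>J. S i)"
    have "(\<Inter>G\<in>\<G>. spindle_reach K T (\<Inter>i\<in>G. S i)) \<noteq> {}"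
    proof (rule starlike_helly[OF card])
      fix G assume "G \<in> \<G>"
      then have "compact (\<Inter>i\<in>G. S i)"
        using ne psubset.prems(2) by (intro compact_INT_nonempty) blast+
      then show "compact (spindle_reach K T (\<Inter>i\<in>G. S i))" using K by (rule compact_spindle_reach)
    next
      fix \<H> assume \<H>: "\<H> \<subseteq> \<G>" "\<H> \<noteq> {}" "\<H> \<noteq> \<G>"
      obtain G where G: "G \<in> \<G>" "G \<notin> \<H>" using \<H> by blast
      \<comment> \<open>Blocks are nonempty and disjoint, so omitting one leaves an index uncovered
        and the induction hypothesis applies.\<close>
      have sub: "\<Union>\<H> \<subset> J"
      proof
        show "\<Union>\<H> \<subseteq> J" using \<H>(1) ne(2) by blast
        obtain g where g: "g \<in> G" using ne(1)[OF G(1)] by blast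
        then have "g \<notin> \<Union>\<H>" using disj[OF G(1)] G(2) \<H>(1) by blast
        moreover have "g \<in> J" using g ne(2)[OF G(1)] by blast
        ultimately show "\<Union>\<H> \<noteq> J" by blast
      qed
      have "\<exists>u. (\<lambda>k. u + k) ` K \<subseteq> spindle_kernel (\<Inter>i\<in>\<Union>\<H>. S i)"
      proof (rule psubset.IH[OF sub])
        show "\<Union>\<H> \<noteq> {}" using \<H> ne(1) by blast
        show "compact (S i)" if "i \<in> \<Union>\<H>" for i using that sub by (intro psubset.prems(2)) blast
        show "\<exists>u. (\<lambda>k. u + k) ` K \<subseteq> spindle_kernel (\<Inter>i\<in>G. S i)"
          if "G \<subseteq> \<Union>\<H>" "G \<noteq> {}" "card G \<le> DIM('a) + 1" for G
          using that sub by (intro psubset.prems(3)) blast+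
      qed
      then obtain u where "(\<lambda>k. u + k) ` K \<subseteq> spindle_kernel (\<Inter>i\<in>\<Union>\<H>. S i)" ..
      moreover have "T \<subseteq> (\<Inter>i\<in>\<Union>\<H>. S i)" using sub by (auto simp: T_def)
      ultimately show "starlike (\<Inter>G\<in>\<H>. spindle_reach K T (\<Inter>i\<in>G. S i))"
        unfolding spindle_reach_INT_Union by (rule starlike_spindle_reach)
    qed
    then obtain v where "v \<in> spindle_reach K T T"
      unfolding spindle_reach_INT_Union Un T_def by blast
    then show ?thesis unfolding T_def by (blast dest: spindle_reach_self)
  qed
qed

theorem theorem5:
  fixes S :: "'i \<Rightarrow> 'a::euclidean_space set" and I :: "'i set" and K :: "'a set"
  assumes "\<And>i. i \<in> I \<Longrightarrow> compact (S i) \<and> spindle_starshaped (S i)"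
    and "infinite I \<or> card I \<ge> DIM('a) + 1"
    and "compact K"
    and "\<And>f :: nat \<Rightarrow> 'i. f ` {..DIM('a)} \<subseteq> I \<Longrightarrow>
           \<exists>u. (\<lambda>k. u + k) ` K \<subseteq> spindle_kernel (\<Inter>j\<in>{..DIM('a)}. S (f j))"
  shows "\<exists>v. (\<lambda>k. v + k) ` K \<subseteq> spindle_kernel (\<Inter>i\<in>I. S i)"
proof (cases "K = {}")
  case False
  have comp: "compact (S i)" if "i \<in> I" for i using assms(1)[OF that] by blast
  have small: "\<exists>u. (\<lambda>k. u + k) ` K \<subseteq> spindle_kernel (\<Inter>i\<in>G. S i)"
    if G: "G \<subseteq> I" "G \<noteq> {}" "finite G" "card G \<le> DIM('a) + 1" for G
  proof -
    obtain g where g: "bij_betw g {0..<card G} G" using ex_bij_betw_nat_finite[OF G(3)] by blast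
    obtain i0 where i0: "i0 \<in> G" using G(2) by blast
    \<comment> \<open>Repeating \<open>i0\<close> pads an enumeration of \<open>G\<close> to
      \<open>DIM('a) + 1\<close> indices; the hypothesis on tuples permits repetitions.\<close>
    define f where "f n = (if n < card G then g n else i0)" for n
    have "{0..<card G} \<subseteq> {..DIM('a)}" using G(4) by auto
    moreover have "f ` {0..<card G} = G" using g by (simp add: f_def bij_betw_def)
    moreover have "f n \<in> G" for n using bij_betwE[OF g] i0 by (simp add: f_def)
    ultimately have fG: "f ` {..DIM('a)} = G" by blast
    then have "(\<Inter>j\<in>{..DIM('a)}. S (f j)) = (\<Inter>i\<in>G. S i)"
      unfolding fG[symmetric] by (simp only: image_image)
    then show ?thesis using assms(4)[of f] fG G(1) by simp
  qed
  have fin: "\<exists>u. (\<lambda>k. u + k) ` K \<subseteq> spindle_kernel (\<Inter>i\<in>J. S i)"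
    if J: "J \<subseteq> I" "J \<noteq> {}" "finite J" for J
  proof (rule kernel_translate_finite)
    show "compact (S i)" if "i \<in> J" for i using that J(1) comp by blast
    show "\<exists>u. (\<lambda>k. u + k) ` K \<subseteq> spindle_kernel (\<Inter>i\<in>G. S i)"
      if "G \<subseteq> J" "G \<noteq> {}" "card G \<le> DIM('a) + 1" for G
      by (rule small) (use that J finite_subset in auto)
  qed (use False J in auto)
  define T where "T = (\<Inter>i\<in>I. S i)"
  have "I \<noteq> {}" using assms(2) by auto
  then obtain i0 where i0: "i0 \<in> I" by blast
  have reach: "compact (spindle_reach K T (S i))" if "i \<in> I" for i
    using comp[OF that] False by (rule compact_spindle_reach)
  \<comment> \<open>Finite intersection property inside the compact reach set of \<open>i0\<close>:
    each finite subfamily supplies a point through its own kernel, although \<open>T\<close> is the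
    full intersection.\<close>
  have "spindle_reach K T (S i0) \<inter> (\<Inter>i\<in>I. spindle_reach K T (S i)) \<noteq> {}"
  proof (rule compact_imp_fip_image)
    show "compact (spindle_reach K T (S i0))" using i0 by (rule reach)
    show "closed (spindle_reach K T (S i))" if "i \<in> I" for i
      using reach[OF that] by (rule compact_imp_closed)
    fix J assume J: "finite J" "J \<subseteq> I"
    then obtain u where u: "(\<lambda>k. u + k) ` K \<subseteq> spindle_kernel (\<Inter>i\<in>insert i0 J. S i)"
      using fin[of "insert i0 J"] i0 by auto
    have "T \<subseteq> (\<Inter>i\<in>insert i0 J. S i)" using J i0 by (auto simp: T_def)
    then have "u \<in> spindle_reach K T (\<Inter>i\<in>insert i0 J. S i)"
      by (rule kernel_translate_in_spindle_reach[OF u])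
    then have "u \<in> spindle_reach K T (S i0) \<inter> (\<Inter>i\<in>J. spindle_reach K T (S i))"
      unfolding spindle_reach_INT[symmetric] by simp
    then show "spindle_reach K T (S i0) \<inter> (\<Inter>i\<in>J. spindle_reach K T (S i)) \<noteq> {}" by blast
  qed
  then obtain v where "v \<in> (\<Inter>i\<in>I. spindle_reach K T (S i))" by blast
  then have "v \<in> spindle_reach K T T" unfolding spindle_reach_INT T_def .
  then show ?thesis unfolding T_def by (blast dest: spindle_reach_self)
qed simp

end
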